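(* Let $I'=(\mathcal{C},w,x'_{min},x'_{max},(f_i)_{i=1}^n)$ be an instance of the Single Row Problem, let $x_{min}\le x'_{min}<x'_{max}\le x_{max}$ be real numbers, and let $I=(\mathcal{C},w,x_{min},x_{max},(f_i)_{i=1}^n)$ be the instance obtained from $I'$ by replacing $x'_{min},x'_{max}$ by $x_{min},x_{max}$. Then there exists an optimum solution $(x^*_i)_{i=1}^n$ of $I'$ such that for every block $B(i)$ that is present at some point during the run of the Clumping Algorithm on $I$, the cells of $B(i)$ are placed contiguously by $(x^*_i)$, i.e. $x^*_{j}+w(C_{j})=x^*_{j+1}$ whenever $C_j,C_{j+1}\in B(i)$.
   Context: Single Row Problem: an instance is a tuple $(\mathcal{C},w,x_{min},x_{max},(f_i)_{i=1}^n)$ with an ordered set of cells $\mathcal{C}=\{C_1,\dots,C_n\}$, widths $w:\mathcal{C}\to\mathbb{R}_{>0}$, reals $x_{min},x_{max}$ with $\sum_{i=1}^n w(C_i)\le x_{max}-x_{min}$, and convex continuous functions $f_i:\mathbb{R}\to\mathbb{R}$. The task is to find reals $(x_i)_{i=1}^n$ minimizing $\sum_i f_i(x_i)$ subject to $x_{min}\le x_1$, $x_i+w(C_i)\le x_{i+1}$ for $i=1,\dots,n-1$, and $x_n+w(C_n)\le x_{max}$. Clumping Algorithm (run on an instance with interval $[x_{min},x_{max}]$): For a cell index $i$ and its current function $f_i$, let $[f_i^-,f_i^+]$ denote the set of minimizers of the current $f_i$ over $[x_{min}+\sum_{j=1}^{i-1}w(C_j),\ x_{max}-\sum_{j=i}^n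 w(C_j)]$. Maintain an ordered list $\mathcal{L}$, initially $(C_0,C_1,\dots,C_n)$ where $C_0$ is an auxiliary element with $x_0:=x_{min}$ and $w_0:=0$; set $w_i:=w(C_i)$ for $i\ge1$. For $i=1,\dots,n$ call PLACE$(C_i)$, where PLACE$(C_i)$ is: let $C_h$ be the predecessor of $C_i$ in $\mathcal{L}$; if $x_h+w_h\le f_i^+$, set $x_i:=\max\{x_h+w_h,f_i^-\}$; otherwise call COLLAPSE$(C_h,C_i)$ and then PLACE$(C_h)$. COLLAPSE$(C_h,C_i)$ redefines $f_h$ as $x\mapsto f_h(x)+f_i(x+w_h)$ (and accordingly $f_h^-,f_h^+$ w.r.t. $[x_{min}+\sum_{j=1}^{h-1}w(C_j),x_{max}-\sum_{j=h}^n w(C_j)]$), sets $w_h:=w_h+w_i$, and removes $C_i$ from $\mathcal{L}$. Finally, for $i=1,\dots,n$ in increasing order with $C_i\notin\mathcal{L}$, set $x_i:=x_{i-1}+w(C_{i-1})$; the output is $(x_i)_{i=1}^n$. Blocks: at any moment of the run, for $C_i\in\mathcal{L}$ with $i\ge1$, the block represented by $C_i$ is $B(i):=\{C_j: i\le j\le n,\ \text{there is no } C_l\in\mathcal{L} \text{ with } i<l\le j\}$. *)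

theory Defs
  imports "HOL-Analysis.Analysis"
begin

text \<open>The cells \<open>C\<^sub>1, \<dots>, C\<^sub>n\<close> are identified with their indices \<open>1, \<dots>, n\<close>; the values of
  \<open>cwidth\<close>, \<open>cost\<close> and of a placement at other indices are irrelevant.\<close>

record srp =
  ncells :: nat
  cwidth :: "nat \<Rightarrow> real"
  xmin :: real
  xmax :: real
  cost :: "nat \<Rightarrow> real \<Rightarrow> real"

definition srp_instance :: "srp \<Rightarrow> bool" where
  "srp_instance I \<longleftrightarrow>
     (\<forall>i\<in>{1..ncells I}. cwidth I i > 0) \<and>
     (\<Sum>i=1..ncells I. cwidth I i) \<le> xmax I - xmin I \<and>
     (\<forall>i\<in>{1..ncells I}. convex_on UNIV (cost I i) \<and> continuous_on UNIV (cost I i))"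

text \<open>The first and last constraints mention cells \<open>1\<close> and \<open>n\<close>, so they are void for \<open>n = 0\<close>.\<close>

definition srp_feasible :: "srp \<Rightarrow> (nat \<Rightarrow> real) \<Rightarrow> bool" where
  "srp_feasible I x \<longleftrightarrow>
     (ncells I \<ge> 1 \<longrightarrow> xmin I \<le> x 1) \<and>
     (\<forall>i\<in>{1..<ncells I}. x i + cwidth I i \<le> x (i + 1)) \<and>
     (ncells I \<ge> 1 \<longrightarrow> x (ncells I) + cwidth I (ncells I) \<le> xmax I)"

definition srp_optimal :: "srp \<Rightarrow> (nat \<Rightarrow> real) \<Rightarrow> bool" where
  "srp_optimal I = is_arg_min (\<lambda>x. \<Sum>i=1..ncells I. cost I i (x i)) (srp_feasible I)"

definition minimizers :: "(real \<Rightarrow> real) \<Rightarrow> real set \<Rightarrow> real set" where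
  "minimizers f S = {x. is_arg_min f (\<lambda>y. y \<in> S) x}"

text \<open>For a convex continuous function on a nonempty compact interval the minimizers form a
  nonempty compact interval, whose endpoints are therefore its infimum and supremum.\<close>

lemma minimizers_eq_interval:
  assumes "convex_on UNIV f" "continuous_on UNIV f" "a \<le> b"
  shows "minimizers f {a..b} \<noteq> {}"
    and "minimizers f {a..b} = {Inf (minimizers f {a..b})..Sup (minimizers f {a..b})}"
proof -
  let ?M = "minimizers f {a..b}"
  have cont: "continuous_on {a..b} f"
    using assms(2) continuous_on_subset by blast
  obtain m where m: "m \<in> {a..b}" "\<forall>y\<in>{a..b}. f m \<le> f y"
    using continuous_attains_inf[OF compact_Icc _ cont] assms(3) by auto
  have M: "?M = {x \<in> {a..b}. f x \<le> f m}"
  proof (intro set_eqI iffI)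
    fix x assume "x \<in> ?M"
    then show "x \<in> {x \<in> {a..b}. f x \<le> f m}"
      using m by (auto simp: minimizers_def is_arg_min_def not_less)
  next
    fix x assume x: "x \<in> {x \<in> {a..b}. f x \<le> f m}"
    then have "f x \<le> f y" if "y \<in> {a..b}" for y
      using m(2) that by force
    with x show "x \<in> ?M"
      by (auto simp: minimizers_def is_arg_min_def not_less)
  qed
  show ne: "?M \<noteq> {}"
    using m(1) by (auto simp: M)
  have "closed ?M"
    unfolding M by (intro continuous_on_closed_Collect_le continuous_on_const cont) simp
  moreover have bdd: "bounded ?M"
    by (rule bounded_subset[of "{a..b}"]) (auto simp: M)
  moreover have "convex ?M"
  proof -
    have "f ((1 - t) * x + t * y) \<le> f m"
      if "f x \<le> f m" "f y \<le> f m" "0 \<le> t" "t \<le> 1" for x y t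
    proof -
      have "f ((1 - t) * x + t * y) \<le> (1 - t) * f x + t * f y"
        using convex_onD[OF assms(1), of t x y] that by simp
      also have "\<dots> \<le> f m"
        using that by (intro convex_bound_le) auto
      finally show ?thesis .
    qed
    then have "convex {x. f x \<le> f m}"
      by (auto simp: convex_alt)
    then have "convex ({a..b} \<inter> {x. f x \<le> f m})"
      by (intro convex_Int) auto
    then show ?thesis by (simp add: M Int_def conj_commute)
  qed
  ultimately obtain c d where cd: "?M = {c..d}"
    using connected_compact_interval_1 compact_eq_bounded_closed convex_connected by metis
  then show "?M = {Inf ?M..Sup ?M}"
    using ne by auto
qed

definition min_left :: "(real \<Rightarrow> real) \<Rightarrow> real set \<Rightarrow> real" where
  "min_left f S = Inf (minimizers f S)"

definition min_right :: "(real \<Rightarrow> real) \<Rightarrow> real set \<Rightarrow> real" where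
  "min_right f S = Sup (minimizers f S)"

definition cell_range :: "srp \<Rightarrow> nat \<Rightarrow> real set" where
  "cell_range I i =
     {xmin I + (\<Sum>j\<in>{1..<i}. cwidth I j) .. xmax I - (\<Sum>j\<in>{i..ncells I}. cwidth I j)}"

text \<open>The variables of the Clumping Algorithm: the list \<open>\<L>\<close> (with \<open>0\<close> for the auxiliary
  element \<open>C\<^sub>0\<close>), and the current \<open>x\<^sub>i\<close>, \<open>w\<^sub>i\<close> and \<open>f\<^sub>i\<close>.\<close>

record clump_state =
  clist :: "nat list"
  pos :: "nat \<Rightarrow> real"
  curw :: "nat \<Rightarrow> real"
  curf :: "nat \<Rightarrow> real \<Rightarrow> real"

text \<open>Control points: \<open>Loop k\<close> is the head of the main loop before iteration \<open>k\<close>; \<open>Place k i\<close> is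
  a pending call of PLACE on cell \<open>i\<close> made within iteration \<open>k\<close>; \<open>Fill i\<close> is the final loop before
  iteration \<open>i\<close>, and \<open>Fill (n + 1)\<close> is the end of the run.\<close>

datatype control = Loop nat | Place nat nat | Fill nat

definition clump_init :: "srp \<Rightarrow> clump_state \<times> control" where
  "clump_init I =
     (\<lparr>clist = [0..<ncells I + 1],
       pos = (\<lambda>_. undefined)(0 := xmin I),
       curw = (cwidth I)(0 := 0),
       curf = cost I\<rparr>, Loop 1)"

definition collapse :: "nat \<Rightarrow> nat \<Rightarrow> clump_state \<Rightarrow> clump_state" where
  "collapse h i s =
     s\<lparr>clist := removeAll i (clist s),
       curw := (curw s)(h := curw s h + curw s i),
       curf := (curf s)(h := (\<lambda>x. curf s h x + curf s i (x + curw s h)))\<rparr>"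

text \<open>The case \<open>h = 0\<close> of \<open>collapse\<close> does not arise in a run on an instance: a cell whose
  predecessor is \<open>C\<^sub>0\<close> is \<open>C\<^sub>1\<close>, and the right minimizer of its function is at least \<open>xmin\<close>.\<close>

inductive clump_step ::
  "srp \<Rightarrow> clump_state \<times> control \<Rightarrow> clump_state \<times> control \<Rightarrow> bool" for I where
  call: "k \<le> ncells I \<Longrightarrow> clump_step I (s, Loop k) (s, Place k k)"
| place: "\<lbrakk>clist s = ps @ [h, i] @ qs;
           pos s h + curw s h \<le> min_right (curf s i) (cell_range I i)\<rbrakk> \<Longrightarrow>
   clump_step I (s, Place k i)
     (s\<lparr>pos := (pos s)(i := max (pos s h + curw s h) (min_left (curf s i) (cell_range I i)))\<rparr>,
      Loop (k + 1))"
| collapse: "\<lbrakk>clist s = ps @ [h, i] @ qs;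
              \<not> pos s h + curw s h \<le> min_right (curf s i) (cell_range I i)\<rbrakk> \<Longrightarrow>
   clump_step I (s, Place k i) (collapse h i s, Place k h)"
| loop_end: "k > ncells I \<Longrightarrow> clump_step I (s, Loop k) (s, Fill 1)"
| fill_skip: "\<lbrakk>i \<le> ncells I; i \<in> set (clist s)\<rbrakk> \<Longrightarrow>
   clump_step I (s, Fill i) (s, Fill (i + 1))"
| fill: "\<lbrakk>i \<le> ncells I; i \<notin> set (clist s)\<rbrakk> \<Longrightarrow>
   clump_step I (s, Fill i)
     (s\<lparr>pos := (pos s)(i := pos s (i - 1) + cwidth I (i - 1))\<rparr>, Fill (i + 1))"

definition block :: "srp \<Rightarrow> clump_state \<Rightarrow> nat \<Rightarrow> nat set" where
  "block I s i = {j. i \<le> j \<and> j \<le> ncells I \<and> \<not> (\<exists>l\<in>set (clist s). i < l \<and> l \<le> j)}"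

definition blocks_during_run :: "srp \<Rightarrow> nat set set" where
  "blocks_during_run I =
     {block I s i | s i. (\<exists>c. (clump_step I)\<^sup>*\<^sup>* (clump_init I) (s, c)) \<and>
        i \<in> set (clist s) \<and> i \<ge> 1}"

end

theory Submission
  imports Defs
begin

text \<open>In the coordinates \<open>y\<^sub>j = x\<^sub>j - (w\<^sub>1 + \<dots> + w\<^sub>j\<^sub>-\<^sub>1)\<close> the constraints say that
  \<open>y\<close> is nondecreasing with values in an interval, blocks are index intervals on which \<open>y\<close> is to be
  constant, and all cells have the same range, so that the algorithm is pool-adjacent-violators. In
  fact every optimum of the smaller instance is constant on all blocks. The reason is that whenever a
  block \<open>h\<close> with end \<open>m\<close> has been placed at \<open>p\<close>, there is a fixed \<open>c \<le> h\<close> such that raising all the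
  cells \<open>c, \<dots>, m - 1\<close> to a common position \<open>t \<le> p\<close> beyond that of block \<open>h\<close> strictly decreases the
  cost: the block starting at \<open>c\<close> sits at its left minimizer \<open>p\<close>, and the later ones, pushed
  against it, sit within their intervals of minimizers. So if \<open>h\<close> and \<open>i\<close> get collapsed because \<open>p\<close>
  exceeds the right minimizer of block \<open>i\<close>, an optimum with a gap between \<open>h\<close> and \<open>i\<close> could be improved
  by lowering block \<open>i\<close> or by raising the cells from \<open>c\<close> on.\<close>

section \<open>Convex functions near their minimizers\<close>

lemma convex_on_le_between:
  fixes f :: "real \<Rightarrow> real"
  assumes "convex_on UNIV f" "f p \<le> f x" "y \<in> closed_segment p x"
  shows "f y \<le> f x"
proof -
  obtain t where t: "0 \<le> t" "t \<le> 1" "y = (1 - t) * p + t * x"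
    using assms(3) by (auto simp: in_segment)
  have "f y \<le> (1 - t) * f p + t * f x"
    using convex_onD[OF assms(1), of t p x] t by simp
  also have "\<dots> \<le> f x"
    using t assms(2) by (intro convex_bound_le) auto
  finally show ?thesis .
qed

lemma convex_on_less_between:
  fixes f :: "real \<Rightarrow> real"
  assumes "convex_on UNIV f" "f p < f x" "y \<in> closed_segment p x" "y \<noteq> x"
  shows "f y < f x"
proof -
  obtain t where t: "0 \<le> t" "t \<le> 1" "y = (1 - t) * p + t * x"
    using assms(3) by (auto simp: in_segment)
  have "t \<noteq> 1"
    using t(3) assms(4) by auto
  then have "(1 - t) * f p < (1 - t) * f x"
    using t(2) assms(2) by simp
  moreover have "f y \<le> (1 - t) * f p + t * f x"
    using convex_onD[OF assms(1), of t p x] t by simp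
  ultimately show ?thesis
    by (simp add: algebra_simps)
qed

context
  fixes f :: "real \<Rightarrow> real" and l u :: real
  assumes conv: "convex_on UNIV f" and cont: "continuous_on UNIV f" and "l \<le> u"
begin

lemma minimizers_Icc:
  "minimizers f {l..u} = {min_left f {l..u}..min_right f {l..u}}"
  "min_left f {l..u} \<le> min_right f {l..u}"
  using minimizers_eq_interval[OF conv cont \<open>l \<le> u\<close>]
  unfolding min_left_def min_right_def by auto

lemma min_left_minimizer: "min_left f {l..u} \<in> minimizers f {l..u}"
  and min_right_minimizer: "min_right f {l..u} \<in> minimizers f {l..u}"
  using minimizers_Icc by auto

lemma min_left_in: "min_left f {l..u} \<in> {l..u}"
  and min_right_in: "min_right f {l..u} \<in> {l..u}"
  using min_left_minimizer min_right_minimizer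
  by (auto simp: minimizers_def is_arg_min_def)

lemma minimizer_less:
  assumes "p \<in> minimizers f {l..u}" "x \<in> {l..u}" "x \<notin> minimizers f {l..u}"
  shows "f p < f x"
  using assms by (force simp: minimizers_def is_arg_min_def not_less)

text \<open>Beyond the largest minimizer but inside the interval, \<open>x\<close> costs strictly
  more than that minimizer; convexity passes the strict inequality on to every point in
  between.\<close>

lemma less_right_of_min_right:
  assumes "min_right f {l..u} \<le> y" "y < x" "x \<le> u"
  shows "f y < f x"
proof (rule convex_on_less_between[OF conv])
  show "f (min_right f {l..u}) < f x"
    using assms min_right_in minimizers_Icc(1) by (intro minimizer_less min_right_minimizer) auto
qed (use assms in \<open>auto simp: closed_segment_eq_real_ivl\<close>)

lemma less_left_of_min_left:
  assumes "l \<le> x" "x < y" "y \<le> min_left f {l..u}"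
  shows "f y < f x"
proof (rule convex_on_less_between[OF conv])
  show "f (min_left f {l..u}) < f x"
    using assms min_left_in minimizers_Icc(1) by (intro minimizer_less min_left_minimizer) auto
qed (use assms in \<open>auto simp: closed_segment_eq_real_ivl\<close>)

text \<open>Only the weak inequality can hold, because both points may be minimizers. This is the
  case of a block pushed to the right of its left minimizer.\<close>

lemma le_left_of_min_right:
  assumes "l \<le> x" "x \<le> y" "y \<le> min_right f {l..u}"
  shows "f y \<le> f x"
proof (rule convex_on_le_between[OF conv])
  show "f (min_right f {l..u}) \<le> f x"
    using assms min_right_minimizer by (auto simp: minimizers_def is_arg_min_def not_less)
qed (use assms in \<open>auto simp: closed_segment_eq_real_ivl\<close>)

end

section \<open>Existence of an optimum\<close>

text \<open>Tychonoff's theorem for boxes in the product topology on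
  \<open>nat \<Rightarrow> real\<close>.\<close>

lemma compact_PiE_UNIV_Icc:
  fixes l u :: "nat \<Rightarrow> real"
  shows "compact (PiE UNIV (\<lambda>i. {l i..u i}))"
proof -
  have "compactin (product_topology (\<lambda>_. euclidean) UNIV) (PiE UNIV (\<lambda>i. {l i..u i}))"
    by (simp add: compactin_PiE)
  then show ?thesis
    by (simp add: euclidean_product_topology)
qed

text \<open>The coordinates outside \<open>{1..n}\<close> are free, so the feasible set is not
  compact. Setting them to 0 changes neither feasibility nor cost and leaves a closed subset of a
  compact box, where a continuous cost attains its minimum.\<close>

lemma srp_optimal_exists:
  assumes inst: "srp_instance I"
  shows "\<exists>x. srp_optimal I x"
proof -
  define n where "n = ncells I"
  define w where "w = cwidth I"
  define Q where "Q = PiE UNIV (\<lambda>i. if i \<in> {1..n} then {xmin I..xmax I} else {0..0})"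
  have w: "\<And>i. i \<in> {1..n} \<Longrightarrow> w i > 0"
    and sum_w: "(\<Sum>i=1..n. w i) \<le> xmax I - xmin I"
    using inst by (auto simp: srp_instance_def n_def w_def)
  have "compact Q"
    unfolding Q_def
    using compact_PiE_UNIV_Icc[of "\<lambda>i. if i \<in> {1..n} then xmin I else 0"
        "\<lambda>i. if i \<in> {1..n} then xmax I else 0"]
    by (auto elim!: back_subst[of compact] intro!: PiE_cong)
  have coord: "continuous_on A (\<lambda>x. x i)" for A :: "(nat \<Rightarrow> real) set" and i
    by (rule continuous_on_subset[OF continuous_on_product_coordinates]) auto
  have "{x. srp_feasible I x} =
      {x. n \<ge> 1 \<longrightarrow> xmin I \<le> x 1} \<inter> (\<Inter>i\<in>{1..<n}. {x. x i + w i \<le> x (i + 1)})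
      \<inter> {x. n \<ge> 1 \<longrightarrow> x n + w n \<le> xmax I}"
    by (auto simp: srp_feasible_def n_def w_def)
  moreover have "closed \<dots>"
    by (intro closed_Int closed_INT ballI closed_Collect_imp open_Collect_const
        closed_Collect_le continuous_intros coord)
  ultimately have "compact (Q \<inter> {x. srp_feasible I x})"
    using \<open>compact Q\<close> by (simp add: compact_Int_closed)
  have restrict: "\<exists>x'\<in>Q \<inter> {x. srp_feasible I x}. \<forall>i\<in>{1..n}. x' i = x i"
    if x: "srp_feasible I x" for x
  proof -
    define x' where "x' i = (if i \<in> {1..n} then x i else 0)" for i
    have step: "x i \<le> x (Suc i)" if "i \<in> {1..<n}" for i
      using x that w[of i] by (force simp: srp_feasible_def n_def w_def)
    have "xmin I \<le> x i \<and> x i \<le> xmax I" if i: "i \<in> {1..n}" for i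
    proof -
      have "x 1 \<le> x i" "x i \<le> x n"
        using i by (auto intro!: lift_Suc_mono_le_ivl[of "{1..<n}" x] step)
      moreover have "xmin I \<le> x 1" "x n + w n \<le> xmax I"
        using i x by (auto simp: srp_feasible_def n_def w_def)
      ultimately show ?thesis
        using w[of n] i by auto
    qed
    then have "x' \<in> Q"
      by (auto simp: Q_def x'_def)
    moreover have "srp_feasible I x'"
      using x by (auto simp: srp_feasible_def x'_def n_def)
    ultimately show ?thesis
      by (intro bexI[of _ x']) (auto simp: x'_def)
  qed
  \<comment> \<open>Packing all cells against the left boundary is feasible because their total
    width fits.\<close>
  define x0 where "x0 i = xmin I + (\<Sum>j\<in>{1..<i}. w j)" for i
  have x0_Suc: "x0 (Suc i) = x0 i + w i" if "i \<ge> 1" for i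
    using that by (simp add: x0_def)
  have "x0 (Suc n) \<le> xmax I"
    using sum_w by (simp add: x0_def atLeastLessThanSuc_atLeastAtMost del: sum.op_ivl_Suc)
  then have "n \<ge> 1 \<longrightarrow> x0 n + w n \<le> xmax I"
    using x0_Suc[of n] by auto
  moreover have "x0 1 = xmin I"
    by (simp add: x0_def)
  ultimately have "srp_feasible I x0"
    using x0_Suc by (simp add: srp_feasible_def n_def w_def)
  then have "Q \<inter> {x. srp_feasible I x} \<noteq> {}"
    using restrict by blast
  moreover have "continuous_on (Q \<inter> {x. srp_feasible I x}) (\<lambda>x. \<Sum>i=1..n. cost I i (x i))"
  proof (intro continuous_on_sum)
    fix i assume "i \<in> {1..n}"
    then have "continuous_on UNIV (cost I i)"
      using inst by (auto simp: srp_instance_def n_def)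
    then show "continuous_on (Q \<inter> {x. srp_feasible I x}) (\<lambda>x. cost I i (x i))"
      by (rule continuous_on_compose2) (auto intro: coord)
  qed
  ultimately obtain x where x: "srp_feasible I x"
    and min: "\<And>y. y \<in> Q \<inter> {x. srp_feasible I x} \<Longrightarrow>
      (\<Sum>i=1..n. cost I i (x i)) \<le> (\<Sum>i=1..n. cost I i (y i))"
    using continuous_attains_inf[OF \<open>compact (Q \<inter> {x. srp_feasible I x})\<close>] by blast
  have "(\<Sum>i=1..n. cost I i (x i)) \<le> (\<Sum>i=1..n. cost I i (y i))" if y: "srp_feasible I y" for y
  proof -
    obtain y' where "y' \<in> Q \<inter> {x. srp_feasible I x}" "\<forall>i\<in>{1..n}. y' i = y i"
      using restrict[OF y] by blast
    then show ?thesis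
      using min[of y'] by simp
  qed
  then show ?thesis
    using x by (auto simp: srp_optimal_def is_arg_min_def not_less n_def)
qed

section \<open>Optima in shifted coordinates\<close>

lemma convex_on_UNIV_translate:
  fixes f :: "real \<Rightarrow> real"
  assumes "convex_on UNIV f"
  shows "convex_on UNIV (\<lambda>x. f (x + c))"
proof (rule convex_onI)
  fix t x y :: real
  assume "0 < t" "t < 1"
  moreover have "(1 - t) *\<^sub>R x + t *\<^sub>R y + c = (1 - t) *\<^sub>R (x + c) + t *\<^sub>R (y + c)"
    by (simp add: algebra_simps)
  ultimately show "f ((1 - t) *\<^sub>R x + t *\<^sub>R y + c) \<le> (1 - t) * f (x + c) + t * f (y + c)"
    using convex_onD[OF assms, of t "x + c" "y + c"] by simp
qed simp

lemma convex_on_UNIV_sum: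
  fixes f :: "'i \<Rightarrow> real \<Rightarrow> real"
  assumes "finite A" "\<And>j. j \<in> A \<Longrightarrow> convex_on UNIV (f j)"
  shows "convex_on UNIV (\<lambda>x. \<Sum>j\<in>A. f j x)"
  using assms by (induction A rule: finite_induct) (auto intro: convex_on_add simp: convex_on_const)

text \<open>The algorithm runs on \<open>I\<close>, the wider instance; the optima considered are
  those of \<open>I'\<close>.\<close>

locale nested_instances =
  fixes I I' :: srp
  assumes inst': "srp_instance I'"
    and xmin_le: "xmin I \<le> xmin I'" and xmax_le: "xmax I' \<le> xmax I"
    and same: "ncells I' = ncells I" "cwidth I' = cwidth I" "cost I' = cost I"
begin

abbreviation n :: nat where "n \<equiv> ncells I"

definition off :: "nat \<Rightarrow> real" where
  "off m = (\<Sum>j\<in>{1..<m}. cwidth I j)"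

text \<open>In original coordinates: the cost of the cells \<open>h\<close>, ...,
  \<open>m - 1\<close> packed contiguously, with cell \<open>h\<close> at
  \<open>t + off h\<close>.\<close>

definition G :: "nat \<Rightarrow> nat \<Rightarrow> real \<Rightarrow> real" where
  "G h m t = (\<Sum>j\<in>{h..<m}. cost I j (t + off j))"

abbreviation lo :: real where "lo \<equiv> xmin I"
abbreviation lo' :: real where "lo' \<equiv> xmin I'"
abbreviation hi :: real where "hi \<equiv> xmax I - off (n + 1)"
abbreviation hi' :: real where "hi' \<equiv> xmax I' - off (n + 1)"

lemma off_Suc: "j \<ge> 1 \<Longrightarrow> off (Suc j) = off j + cwidth I j"
  by (simp add: off_def)

lemma off_le_1 [simp]: "m \<le> 1 \<Longrightarrow> off m = 0"
  by (simp add: off_def)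

lemma lo'_le_hi': "lo' \<le> hi'"
  using inst'
  by (simp add: srp_instance_def off_def same atLeastLessThanSuc_atLeastAtMost
      del: sum.op_ivl_Suc)

lemma lo_le_hi: "lo \<le> hi"
  using lo'_le_hi' xmin_le xmax_le by simp

lemma cost_convex: "j \<in> {1..n} \<Longrightarrow> convex_on UNIV (cost I j)"
  and cost_cont: "j \<in> {1..n} \<Longrightarrow> continuous_on UNIV (cost I j)"
  using inst' by (auto simp: srp_instance_def same)

lemma cell_range_eq:
  assumes "1 \<le> i" "i \<le> n + 1"
  shows "cell_range I i = {lo + off i..hi + off i}"
proof -
  have "off (n + 1) = off i + (\<Sum>j\<in>{i..n}. cwidth I j)"
    unfolding off_def using assms sum.atLeastLessThan_concat[of 1 i "n + 1" "cwidth I"]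
    by (simp add: atLeastLessThanSuc_atLeastAtMost del: sum.op_ivl_Suc)
  then show ?thesis
    by (simp add: cell_range_def off_def)
qed

text \<open>The function minimized is the one the algorithm stores for this block, in terms of the
  actual position of cell \<open>i\<close>. Subtracting \<open>off i\<close> makes the minimizers of
  different blocks comparable.\<close>

definition opt_left :: "nat \<Rightarrow> nat \<Rightarrow> real" where
  "opt_left i m = min_left (\<lambda>x. G i m (x - off i)) (cell_range I i) - off i"

definition opt_right :: "nat \<Rightarrow> nat \<Rightarrow> real" where
  "opt_right i m = min_right (\<lambda>x. G i m (x - off i)) (cell_range I i) - off i"

context
  fixes i m :: nat
  assumes im: "1 \<le> i" "i < m" "m \<le> n + 1"
begin

lemma G_shift_convex: "convex_on UNIV (\<lambda>x. G i m (x - off i))"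
  unfolding G_def
proof (rule convex_on_UNIV_sum)
  fix j assume "j \<in> {i..<m}"
  then show "convex_on UNIV (\<lambda>x. cost I j (x - off i + off j))"
    using im convex_on_UNIV_translate[OF cost_convex, of j "off j - off i"]
    by (simp add: algebra_simps)
qed simp

lemma G_shift_cont: "continuous_on UNIV (\<lambda>x. G i m (x - off i))"
  unfolding G_def using im
  by (intro continuous_on_sum continuous_on_compose2[OF cost_cont] continuous_intros) auto

lemma range_nonempty: "lo + off i \<le> hi + off i"
  using lo_le_hi by simp

lemmas G_facts = G_shift_convex G_shift_cont range_nonempty

lemma range_i: "cell_range I i = {lo + off i..hi + off i}"
  using im by (intro cell_range_eq) auto

lemma opt_left_in: "lo \<le> opt_left i m" "opt_left i m \<le> hi"
  and opt_right_in: "lo \<le> opt_right i m" "opt_right i m \<le> hi"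
  using min_left_in[OF G_facts] min_right_in[OF G_facts]
  unfolding opt_left_def opt_right_def range_i by auto

lemma G_less_right:
  assumes "opt_right i m \<le> s" "s < t" "t \<le> hi"
  shows "G i m s < G i m t"
  using less_right_of_min_right[OF G_facts, of "s + off i" "t + off i"] assms
  unfolding opt_right_def range_i by auto

lemma G_less_left:
  assumes "lo \<le> s" "s < t" "t \<le> opt_left i m"
  shows "G i m t < G i m s"
  using less_left_of_min_left[OF G_facts, of "s + off i" "t + off i"] assms
  unfolding opt_left_def range_i by auto

lemma G_le_left:
  assumes "lo \<le> s" "s \<le> t" "t \<le> opt_right i m"
  shows "G i m t \<le> G i m s"
  using le_left_of_min_right[OF G_facts, of "s + off i" "t + off i"] assms
  unfolding opt_right_def range_i by auto

end

definition isotone :: "(nat \<Rightarrow> real) \<Rightarrow> bool" where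
  "isotone y \<longleftrightarrow> (\<forall>j\<in>{1..n}. lo' \<le> y j \<and> y j \<le> hi') \<and> (\<forall>j\<in>{1..<n}. y j \<le> y (Suc j))"

definition total_cost :: "(nat \<Rightarrow> real) \<Rightarrow> real" where
  "total_cost y = (\<Sum>j\<in>{1..<n+1}. cost I j (y j + off j))"

lemma isotone_le:
  assumes "isotone y" "1 \<le> j" "j \<le> k" "k \<le> n"
  shows "y j \<le> y k"
  by (rule lift_Suc_mono_le_ivl[of "{1..<n}" y]) (use assms in \<open>auto simp: isotone_def\<close>)

lemma feasible_iff_isotone: "srp_feasible I' (\<lambda>j. y j + off j) \<longleftrightarrow> isotone y"
proof
  assume feas: "srp_feasible I' (\<lambda>j. y j + off j)"
  have step: "y j \<le> y (Suc j)" if "j \<in> {1..<n}" for j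
    using feas that off_Suc[of j] by (force simp: srp_feasible_def same)
  have "lo' \<le> y j \<and> y j \<le> hi'" if j: "j \<in> {1..n}" for j
  proof -
    have "y 1 \<le> y j" "y j \<le> y n"
      using j by (auto intro!: lift_Suc_mono_le_ivl[of "{1..<n}" y] step)
    moreover have "lo' \<le> y 1" "y n \<le> hi'"
      using feas j off_Suc[of n] by (auto simp: srp_feasible_def same)
    ultimately show ?thesis by simp
  qed
  with step show "isotone y"
    by (auto simp: isotone_def)
next
  assume y: "isotone y"
  have "lo' \<le> y 1 \<and> y n + off n + cwidth I n \<le> xmax I'" if "n \<ge> 1"
    using y that off_Suc[of n] by (force simp: isotone_def)
  then show "srp_feasible I' (\<lambda>j. y j + off j)"
    using y off_Suc by (auto simp: srp_feasible_def same isotone_def)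
qed

definition optimal :: "(nat \<Rightarrow> real) \<Rightarrow> bool" where
  "optimal y \<longleftrightarrow> srp_optimal I' (\<lambda>j. y j + off j)"

lemma optimal_iff: "optimal y \<longleftrightarrow> isotone y \<and> (\<forall>z. isotone z \<longrightarrow> total_cost y \<le> total_cost z)"
proof -
  have "(\<forall>x. srp_feasible I' x \<longrightarrow> total_cost y \<le> (\<Sum>j=1..n. cost I j (x j))) \<longleftrightarrow>
      (\<forall>z. isotone z \<longrightarrow> total_cost y \<le> total_cost z)" (is "?L \<longleftrightarrow> ?R")
  proof
    assume ?L
    then show ?R
      using feasible_iff_isotone
      by (auto simp: total_cost_def atLeastLessThanSuc_atLeastAtMost simp del: sum.op_ivl_Suc)
  next
    assume R: ?R
    show ?L
    proof (intro allI impI)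
      fix x assume "srp_feasible I' x"
      then have "isotone (\<lambda>j. x j - off j)"
        using feasible_iff_isotone[of "\<lambda>j. x j - off j"] by simp
      then have "total_cost y \<le> total_cost (\<lambda>j. x j - off j)"
        using R by blast
      then show "total_cost y \<le> (\<Sum>j=1..n. cost I j (x j))"
        by (simp add: total_cost_def atLeastLessThanSuc_atLeastAtMost del: sum.op_ivl_Suc)
    qed
  qed
  then show ?thesis
    by (simp add: optimal_def srp_optimal_def is_arg_min_linorder feasible_iff_isotone same
        total_cost_def atLeastLessThanSuc_atLeastAtMost del: sum.op_ivl_Suc)
qed

text \<open>Exchange argument: \<open>t\<close> fits between the neighbouring values, so levelling
  the cells \<open>c\<close>, ..., \<open>m - 1\<close> at \<open>t\<close> keeps the vector isotone
  and cannot beat the optimum. The terms of all other cells cancel.\<close>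

lemma optimal_le_level:
  assumes y: "optimal y" and cm: "1 \<le> c" "c < m" "m \<le> n + 1"
    and t: "lo' \<le> t" "t \<le> hi'"
    and left: "1 < c \<Longrightarrow> y (c - 1) \<le> t" and right: "m \<le> n \<Longrightarrow> t \<le> y m"
  shows "(\<Sum>j\<in>{c..<m}. cost I j (y j + off j)) \<le> G c m t"
proof -
  define z where "z j = (if j \<in> {c..<m} then t else y j)" for j
  have iso: "isotone y"
    using y optimal_iff by blast
  have "z j \<le> z (Suc j)" if j: "j \<in> {1..<n}" for j
  proof -
    \<comment> \<open>Monotonicity could fail only at the two ends of the levelled stretch.\<close>
    consider "Suc j = c" | "Suc j = m" | "Suc j \<noteq> c" "Suc j \<noteq> m"
      by blast
    then show ?thesis
      using iso j left right cm by cases (auto simp: z_def isotone_def)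
  qed
  then have "isotone z"
    using iso t by (auto simp: isotone_def z_def)
  then have le: "total_cost y \<le> total_cost z"
    using y optimal_iff by blast
  have split: "total_cost x = (\<Sum>j\<in>{1..<n+1} - {c..<m}. cost I j (x j + off j))
      + (\<Sum>j\<in>{c..<m}. cost I j (x j + off j))" for x
    unfolding total_cost_def using cm by (intro sum.subset_diff) auto
  have "(\<Sum>j\<in>{1..<n+1} - {c..<m}. cost I j (z j + off j))
      = (\<Sum>j\<in>{1..<n+1} - {c..<m}. cost I j (y j + off j))"
    by (intro sum.cong) (auto simp: z_def)
  moreover have "(\<Sum>j\<in>{c..<m}. cost I j (z j + off j)) = G c m t"
    unfolding G_def by (intro sum.cong) (auto simp: z_def)
  ultimately show ?thesis
    using le split[of y] split[of z] by simp
qed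

section \<open>The invariant of the run\<close>

text \<open>Adding \<open>n + 1\<close> to the list makes every block an interval between adjacent elements.\<close>

definition starts :: "clump_state \<Rightarrow> nat set" where
  "starts s = insert (n + 1) (set (clist s))"

definition adjacent :: "nat set \<Rightarrow> nat \<Rightarrow> nat \<Rightarrow> bool" where
  "adjacent S h m \<longleftrightarrow> h \<in> S \<and> m \<in> S \<and> h < m \<and> S \<inter> {h<..<m} = {}"

definition admissible :: "nat set \<Rightarrow> (nat \<Rightarrow> real) \<Rightarrow> bool" where
  "admissible S y \<longleftrightarrow> isotone y \<and> (\<forall>j\<in>{1..<n}. Suc j \<notin> S \<longrightarrow> y j = y (Suc j))"

text \<open>One \<open>c\<close> serves all \<open>y\<close> and \<open>t\<close>. The vectors
  compared are already constant on the blocks, so their block costs are values of \<open>G\<close>;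
  merging blocks shrinks this class, hence the property survives a collapse.\<close>

definition raisable :: "nat set \<Rightarrow> nat \<Rightarrow> nat \<Rightarrow> real \<Rightarrow> bool" where
  "raisable S h m p \<longleftrightarrow> (\<exists>c. 1 \<le> c \<and> c \<le> h \<and>
     (\<forall>y t. admissible S y \<and> y h < t \<and> t \<le> p \<longrightarrow>
        G c m t < (\<Sum>j\<in>{c..<m}. cost I j (y j + off j))))"

definition well_formed :: "clump_state \<Rightarrow> bool" where
  "well_formed s \<longleftrightarrow>
     sorted_wrt (<) (clist s) \<and> 1 \<in> starts s \<and> set (clist s) \<subseteq> {..n} \<and>
     pos s 0 = lo \<and>
     (\<forall>h m. adjacent (starts s) h m \<longrightarrow> curw s h = off m - off h) \<and>
     (\<forall>h m. adjacent (starts s) h m \<and> 1 \<le> h \<longrightarrow> curf s h = (\<lambda>x. G h m (x - off h)))"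

definition placed_below :: "clump_state \<Rightarrow> nat \<Rightarrow> bool" where
  "placed_below s k \<longleftrightarrow>
     (\<forall>h m. adjacent (starts s) h m \<and> 1 \<le> h \<and> h < k \<longrightarrow>
        raisable (starts s) h m (pos s h - off h))"

definition all_optima_admissible :: "clump_state \<Rightarrow> bool" where
  "all_optima_admissible s \<longleftrightarrow> (\<forall>y. optimal y \<longrightarrow> admissible (starts s) y)"

text \<open>At \<open>Place k i\<close> the pending block consists of the cells \<open>i\<close>,
  ..., \<open>k\<close>; only the blocks before it have valid positions, and the cells after
  \<open>k\<close> are still singletons. The final loop leaves the list unchanged, so there the
  admissibility of the optima in \<open>run_inv\<close> suffices.\<close>

fun control_inv :: "clump_state \<Rightarrow> control \<Rightarrow> bool" where
  "control_inv s (Loop k) \<longleftrightarrow>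
     well_formed s \<and> placed_below s k \<and> 1 \<le> k \<and> {k..n + 1} \<subseteq> starts s"
| "control_inv s (Place k i) \<longleftrightarrow>
     well_formed s \<and> placed_below s i \<and> 1 \<le> i \<and> k \<le> n \<and> {k + 1..n + 1} \<subseteq> starts s \<and>
     adjacent (starts s) i (k + 1)"
| "control_inv s (Fill i) \<longleftrightarrow> True"

definition run_inv :: "clump_state \<times> control \<Rightarrow> bool" where
  "run_inv = (\<lambda>(s, c). control_inv s c \<and> all_optima_admissible s)"

section \<open>Vectors constant on blocks, and adjacent block starts\<close>

lemma admissible_const:
  assumes "admissible S y" "adjacent S h m" "1 \<le> h" "m \<le> n + 1" "j \<in> {h..<m}"
  shows "y j = y h"
proof -
  have "h \<le> j" "j < m"
    using assms(5) by auto
  then show ?thesis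
  proof (induction j rule: dec_induct)
    case (step j)
    then have "j \<in> {1..<n}" "Suc j \<notin> S"
      using assms by (auto simp: adjacent_def)
    then show ?case
      using step assms(1) by (auto simp: admissible_def)
  qed simp
qed

lemma admissible_sum:
  assumes "admissible S y" "adjacent S h m" "1 \<le> h" "m \<le> n + 1"
  shows "(\<Sum>j\<in>{h..<m}. cost I j (y j + off j)) = G h m (y h)"
  unfolding G_def
proof (rule sum.cong)
  fix j assume "j \<in> {h..<m}"
  then have "y j = y h"
    by (rule admissible_const[OF assms])
  then show "cost I j (y j + off j) = cost I j (y h + off j)"
    by simp
qed simp

lemma admissible_mono: "admissible S y \<Longrightarrow> S \<subseteq> S' \<Longrightarrow> admissible S' y"
  by (auto simp: admissible_def)

lemma raisable_mono: "raisable S h m p \<Longrightarrow> S' \<subseteq> S \<Longrightarrow> raisable S' h m p"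
  unfolding raisable_def using admissible_mono[of S' _ S] by blast

lemma list_adjacent:
  assumes "well_formed s" "clist s = ps @ [h, i] @ qs"
  shows "adjacent (starts s) h i"
proof -
  have "sorted_wrt (<) (ps @ [h, i] @ qs)" "set (ps @ [h, i] @ qs) \<subseteq> {..n}"
    using assms by (auto simp: well_formed_def)
  then show ?thesis
    unfolding adjacent_def starts_def assms(2) by (force simp: sorted_wrt_append)
qed

lemma adjacent_le:
  assumes "adjacent S h m" "u \<in> S" "h < u"
  shows "m \<le> u"
proof -
  have "u \<notin> {h<..<m}"
    using assms(1,2) by (auto simp: adjacent_def)
  then show ?thesis
    using assms(3) by simp
qed

lemma adjacent_unique:
  assumes "adjacent S h m" "adjacent S h m'"
  shows "m = m'"
proof (rule antisym)
  show "m \<le> m'"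
    using assms(2) by (intro adjacent_le[OF assms(1)]) (auto simp: adjacent_def)
  show "m' \<le> m"
    using assms(1) by (intro adjacent_le[OF assms(2)]) (auto simp: adjacent_def)
qed

text \<open>Removing \<open>i\<close> disturbs only the two pairs that meet at \<open>i\<close>. For
  a surviving pair, \<open>u < h \<or> m \<le> u\<close> ensures that the updates of
  \<open>collapse\<close> at \<open>h\<close> do not touch it.\<close>

lemma adjacent_remove:
  assumes hi: "adjacent S h i" and im: "adjacent S i m" and uv: "adjacent (S - {i}) u v"
  shows "u = h \<and> v = m \<or> (u < h \<or> m \<le> u) \<and> adjacent S u v"
proof -
  have *: "u \<in> S" "v \<in> S" "u \<noteq> i" "v \<noteq> i" "u < v" "\<And>x. x \<in> S \<Longrightarrow> u < x \<Longrightarrow> x < v \<Longrightarrow> x = i"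
    using uv by (auto simp: adjacent_def)
  have h: "h \<in> S" "i \<in> S" "m \<in> S" "h < i" "i < m"
    using hi im by (auto simp: adjacent_def)
  have keep: "adjacent S u v" if "\<not> (u < i \<and> i < v)"
  proof -
    have "x \<notin> {u<..<v}" if "x \<in> S" for x
      using *(6)[OF that] \<open>\<not> (u < i \<and> i < v)\<close> by (cases "x = i") auto
    then show ?thesis
      using *(1,2,5) by (simp add: adjacent_def disjoint_iff)
  qed
  consider "u < h" | "u = h" | "h < u"
    by linarith
  then show ?thesis
  proof cases
    case 1
    then have "v \<le> h"
      using *(6)[of h] h by force
    then show ?thesis
      using 1 keep h by linarith
  next
    case 2
    then have "i \<le> v"
      using adjacent_le[OF hi] *(2,5) by blast
    then have "m \<le> v"
      using adjacent_le[OF im *(2)] *(4) by simp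
    moreover have "v \<le> m"
      using 2 *(6)[of m] h by force
    ultimately show ?thesis
      using 2 by simp
  next
    case 3
    then have "i \<le> u"
      using adjacent_le[OF hi] *(1) by blast
    then have "m \<le> u"
      using adjacent_le[OF im *(1)] *(3) by simp
    then show ?thesis
      using keep h by linarith
  qed
qed

section \<open>A single call of PLACE: placement or collapse\<close>

context
  fixes s :: clump_state and k h i :: nat and ps qs :: "nat list"
  assumes inv: "run_inv (s, Place k i)" and list: "clist s = ps @ [h, i] @ qs"
begin

lemma place_facts:
  shows wf: "well_formed s" and placed: "placed_below s i" and i_ge: "1 \<le> i" and k_le: "k \<le> n"
    and adj_i: "adjacent (starts s) i (k + 1)" and adj_h: "adjacent (starts s) h i"
    and i_le: "i < k + 1"
  using inv list_adjacent[OF _ list] by (auto simp: run_inv_def adjacent_def)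

text \<open>A block pushed against its predecessor gets the same shifted coordinate, so the test in
  PLACE compares \<open>pos s h - off h\<close> with \<open>opt_right i (k + 1)\<close>.\<close>

lemma pos_plus_width: "pos s h + curw s h = (pos s h - off h) + off i"
  using wf adj_h by (auto simp: well_formed_def)

lemma curf_i: "curf s i = (\<lambda>x. G i (k + 1) (x - off i))"
  using wf adj_i i_ge by (auto simp: well_formed_def)

lemma right_i: "min_right (curf s i) (cell_range I i) = opt_right i (k + 1) + off i"
  and left_i: "min_left (curf s i) (cell_range I i) = opt_left i (k + 1) + off i"
  by (simp_all add: curf_i opt_right_def opt_left_def)

lemma pos_first: "h = 0 \<Longrightarrow> pos s h - off h = lo"
  using wf by (auto simp: well_formed_def)

lemma raisable_h:
  assumes "h \<noteq> 0"
  shows "raisable (starts s) h i (pos s h - off h)"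
  using placed adj_h assms by (auto simp: placed_below_def adjacent_def)

text \<open>A block at its own left minimizer starts a new group, with \<open>c = i\<close>. A block
  pushed against \<open>h\<close> joins the group of \<open>h\<close>: raising strictly helps the
  earlier cells and does not hurt block \<open>i\<close>, since the target is at most its right
  minimizer.\<close>

lemma raisable_place:
  assumes le: "pos s h - off h \<le> opt_right i (k + 1)"
  shows "raisable (starts s) i (k + 1) (max (pos s h - off h) (opt_left i (k + 1)))"
proof (cases "pos s h - off h \<le> opt_left i (k + 1)")
  case True
  have "G i (k + 1) t < (\<Sum>j\<in>{i..<k + 1}. cost I j (y j + off j))"
    if y: "admissible (starts s) y" "y i < t" "t \<le> opt_left i (k + 1)" for y t
  proof -
    have "lo \<le> y i"
      using y(1) i_ge i_le k_le xmin_le by (force simp: admissible_def isotone_def)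
    then show ?thesis
      using admissible_sum[OF y(1) adj_i] G_less_left[of i "k + 1" "y i" t] y i_ge i_le k_le
      by simp
  qed
  then show ?thesis
    using True i_ge unfolding raisable_def by (intro exI[of _ i]) (auto simp: max_def)
next
  case False
  \<comment> \<open>The auxiliary element sits at \<open>lo\<close>, which exceeds no left
    minimizer, so the predecessor is a genuine block.\<close>
  have "h \<noteq> 0"
    using False pos_first opt_left_in(1)[of i "k + 1"] i_ge i_le k_le
    by (metis Suc_eq_plus1 Suc_le_mono)
  obtain c where c: "1 \<le> c" "c \<le> h" and raise: "\<And>y t. admissible (starts s) y \<Longrightarrow> y h < t \<Longrightarrow>
      t \<le> pos s h - off h \<Longrightarrow> G c i t < (\<Sum>j\<in>{c..<i}. cost I j (y j + off j))"
    using raisable_h[OF \<open>h \<noteq> 0\<close>] by (auto simp: raisable_def)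
  have "h < i"
    using adj_h by (simp add: adjacent_def)
  have "G c (k + 1) t < (\<Sum>j\<in>{c..<k + 1}. cost I j (y j + off j))"
    if y: "admissible (starts s) y" "y i < t" "t \<le> pos s h - off h" for y t
  proof -
    have iso: "isotone y"
      using y(1) by (simp add: admissible_def)
    \<comment> \<open>This gives \<open>y h < t\<close>, as required to apply the raising property
      of block \<open>h\<close>.\<close>
    have "y h \<le> y i"
      using \<open>h \<noteq> 0\<close> \<open>h < i\<close> i_le k_le by (intro isotone_le[OF iso]) auto
    then have *: "G c i t < (\<Sum>j\<in>{c..<i}. cost I j (y j + off j))"
      using raise y by simp
    have "lo \<le> y i"
      using iso i_ge i_le k_le xmin_le by (force simp: isotone_def)
    then have "G i (k + 1) t \<le> (\<Sum>j\<in>{i..<k + 1}. cost I j (y j + off j))"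
      using admissible_sum[OF y(1) adj_i] G_le_left[of i "k + 1" "y i" t] y le i_ge i_le k_le
      by simp
    then show ?thesis
      using * c \<open>h < i\<close> i_le
        sum.atLeastLessThan_concat[of c i "k + 1" "\<lambda>j. cost I j (y j + off j)"]
        sum.atLeastLessThan_concat[of c i "k + 1" "\<lambda>j. cost I j (t + off j)"]
      unfolding G_def by linarith
  qed
  then show ?thesis
    using False c \<open>h < i\<close> unfolding raisable_def by (intro exI[of _ c]) (auto simp: max_def)
qed

lemma run_inv_place:
  assumes "pos s h + curw s h \<le> min_right (curf s i) (cell_range I i)"
  shows "run_inv (s\<lparr>pos := (pos s)(i := max (pos s h + curw s h)
      (min_left (curf s i) (cell_range I i)))\<rparr>, Loop (k + 1))"
proof -
  define s' where "s' = s\<lparr>pos := (pos s)(i := max (pos s h + curw s h)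
      (min_left (curf s i) (cell_range I i)))\<rparr>"
  have starts: "starts s' = starts s"
    by (simp add: s'_def starts_def)
  have pos_i: "pos s' i - off i = max (pos s h - off h) (opt_left i (k + 1))"
    by (simp add: s'_def pos_plus_width left_i max_def)
  have rais: "raisable (starts s) i (k + 1) (pos s' i - off i)"
    unfolding pos_i using assms by (intro raisable_place) (simp add: pos_plus_width right_i)
  have "well_formed s'"
    using wf i_ge unfolding well_formed_def starts by (simp add: s'_def)
  moreover have "placed_below s' (k + 1)"
    unfolding placed_below_def starts
  proof (intro allI impI)
    fix u v assume uv: "adjacent (starts s) u v \<and> 1 \<le> u \<and> u < k + 1"
    then have "u \<le> i"
      using adjacent_le[OF adj_i, of u] by (force simp: adjacent_def)
    then consider "u < i" | "u = i" "v = k + 1"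
      using uv adj_i adjacent_unique by (metis le_neq_implies_less)
    then show "raisable (starts s) u v (pos s' u - off u)"
    proof cases
      case 1
      then show ?thesis
        using placed uv by (auto simp: placed_below_def s'_def)
    qed (use rais in simp)
  qed
  ultimately show ?thesis
    using inv unfolding s'_def[symmetric]
    by (auto simp: run_inv_def starts all_optima_admissible_def)
qed

lemma optimum_no_gap:
  assumes gt: "pos s h - off h > opt_right i (k + 1)" and "h \<noteq> 0" and y: "optimal y"
  shows "y h = y i"
proof (rule ccontr)
  assume "y h \<noteq> y i"
  have adm: "admissible (starts s) y"
    using inv y by (auto simp: run_inv_def all_optima_admissible_def)
  have iso: "isotone y"
    using adm by (simp add: admissible_def)
  have "h < i"
    using adj_h by (simp add: adjacent_def)
  then have less: "y h < y i"
    using isotone_le[OF iso, of h i] \<open>y h \<noteq> y i\<close> \<open>h \<noteq> 0\<close> i_le k_le by simp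
  have prev: "y (i - 1) = y h"
    using \<open>h < i\<close> \<open>h \<noteq> 0\<close> i_le k_le by (intro admissible_const[OF adm adj_h]) auto
  have range: "lo' \<le> y h" "y i \<le> hi'"
    using iso \<open>h < i\<close> \<open>h \<noteq> 0\<close> i_le k_le by (auto simp: isotone_def)
  show False
  proof (cases "y i > opt_right i (k + 1)")
    case True
    \<comment> \<open>Block \<open>i\<close> is lowered towards its right minimizer, but not below
      block \<open>h\<close>. The maximum also keeps \<open>t\<close> above \<open>lo'\<close>,
      whereas \<open>opt_right\<close> refers to the wider interval and may lie below it.\<close>
    define t where "t = max (y h) (opt_right i (k + 1))"
    have "(\<Sum>j\<in>{i..<k + 1}. cost I j (y j + off j)) \<le> G i (k + 1) t"
    proof (rule optimal_le_level[OF y])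
      show "k + 1 \<le> n \<Longrightarrow> t \<le> y (k + 1)"
        using True less isotone_le[OF iso, of i "k + 1"] i_ge i_le by (simp add: t_def)
    qed (use True less range prev i_ge i_le k_le in \<open>auto simp: t_def\<close>)
    moreover have "(\<Sum>j\<in>{i..<k + 1}. cost I j (y j + off j)) = G i (k + 1) (y i)"
      using i_ge k_le by (intro admissible_sum[OF adm adj_i]) auto
    moreover have "G i (k + 1) t < G i (k + 1) (y i)"
      using True less range xmax_le i_ge i_le k_le by (intro G_less_right) (auto simp: t_def)
    ultimately show False by simp
  next
    case False
    \<comment> \<open>Here \<open>y i\<close> is a legitimate target: it lies above
      \<open>y h\<close> and, being at most \<open>opt_right i (k + 1)\<close>, below the position
      of block \<open>h\<close>. As a value of \<open>y\<close> it also respects the bounds of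
      \<open>I'\<close>.\<close>
    obtain c where c: "1 \<le> c" "c \<le> h"
      and raise: "G c i (y i) < (\<Sum>j\<in>{c..<i}. cost I j (y j + off j))"
      using raisable_h[OF \<open>h \<noteq> 0\<close>] adm less False gt unfolding raisable_def
      by (meson less_imp_le not_less order_trans)
    have "(\<Sum>j\<in>{c..<i}. cost I j (y j + off j)) \<le> G c i (y i)"
    proof (rule optimal_le_level[OF y])
      show "1 < c \<Longrightarrow> y (c - 1) \<le> y i"
        using c \<open>h < i\<close> i_le k_le by (intro isotone_le[OF iso]) auto
    qed (use c range less \<open>h < i\<close> i_le k_le in auto)
    with raise show False by simp
  qed
qed

lemma run_inv_collapse:
  assumes "\<not> pos s h + curw s h \<le> min_right (curf s i) (cell_range I i)"
  shows "run_inv (collapse h i s, Place k h)"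
proof -
  define s' where "s' = collapse h i s"
  have gt: "pos s h - off h > opt_right i (k + 1)"
    using assms by (simp add: pos_plus_width right_i)
  \<comment> \<open>Right minimizers are at least \<open>lo\<close>, the position of the auxiliary
    element, so a collapse into that element is impossible.\<close>
  have "h \<noteq> 0"
    using gt pos_first opt_right_in(1)[of i "k + 1"] i_ge i_le k_le
    by (metis Suc_eq_plus1 Suc_le_mono not_le)
  have "h < i"
    using adj_h by (simp add: adjacent_def)
  have starts: "starts s' = starts s - {i}"
    using i_le k_le by (auto simp: s'_def collapse_def starts_def)
  have adj': "adjacent (starts s - {i}) h (k + 1)"
    using adj_h adj_i \<open>h < i\<close> by (force simp: adjacent_def)
  have sel: "pos s' = pos s" "curw s' = (curw s)(h := curw s h + curw s i)"
    "curf s' = (curf s)(h := (\<lambda>x. curf s h x + curf s i (x + curw s h)))"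
    "clist s' = removeAll i (clist s)"
    by (simp_all add: s'_def collapse_def)
  have widths: "curw s h = off i - off h" "curw s i = off (k + 1) - off i"
    and curf_h: "curf s h = (\<lambda>x. G h i (x - off h))"
    using wf adj_h adj_i \<open>h \<noteq> 0\<close> by (auto simp: well_formed_def)
  \<comment> \<open>The shift by \<open>curw s h = off i - off h\<close> in COLLAPSE evaluates both
    functions at the same shifted coordinate, so the costs simply add up.\<close>
  have G_join: "G h i t + G i (k + 1) t = G h (k + 1) t" for t
    unfolding G_def using \<open>h < i\<close> i_le by (intro sum.atLeastLessThan_concat) auto
  have "curw s' u = off v - off u \<and> (1 \<le> u \<longrightarrow> curf s' u = (\<lambda>x. G u v (x - off u)))"
    if "adjacent (starts s - {i}) u v" for u v
    using adjacent_remove[OF adj_h adj_i that]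
  proof (elim disjE conjE)
    assume "u = h" "v = k + 1"
    then show ?thesis
      using G_join by (simp add: sel widths curf_h curf_i)
  next
    assume "adjacent (starts s) u v" "u < h"
    then show ?thesis
      using wf by (auto simp: sel well_formed_def)
  next
    assume "adjacent (starts s) u v" "k + 1 \<le> u"
    then show ?thesis
      using wf \<open>h < i\<close> i_le by (auto simp: sel well_formed_def)
  qed
  moreover have "sorted_wrt (<) (clist s')"
    using wf by (auto simp: sel well_formed_def removeAll_filter_not_eq sorted_wrt_filter)
  ultimately have "well_formed s'"
    using wf \<open>h < i\<close> \<open>h \<noteq> 0\<close> unfolding well_formed_def starts by (auto simp: sel)
  moreover have "placed_below s' h"
    unfolding placed_below_def starts
  proof (intro allI impI)
    fix u v assume uv: "adjacent (starts s - {i}) u v \<and> 1 \<le> u \<and> u < h"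
    then have "adjacent (starts s) u v"
      using adjacent_remove[OF adj_h adj_i] by blast
    then have "raisable (starts s) u v (pos s u - off u)"
      using placed uv \<open>h < i\<close> by (auto simp: placed_below_def)
    then show "raisable (starts s - {i}) u v (pos s' u - off u)"
      unfolding sel by (rule raisable_mono) auto
  qed
  moreover have "all_optima_admissible s'"
    unfolding all_optima_admissible_def starts admissible_def
  proof (intro allI impI conjI ballI)
    fix y assume y: "optimal y"
    then have adm: "admissible (starts s) y"
      using inv by (auto simp: run_inv_def all_optima_admissible_def)
    then show "isotone y"
      by (simp add: admissible_def)
    fix j assume j: "j \<in> {1..<n}" "Suc j \<notin> starts s - {i}"
    show "y j = y (Suc j)"
    \<comment> \<open>The only new equality demanded is the one across the removed start
      \<open>i\<close>.\<close>
    proof (cases "Suc j = i")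
      case True
      have "y j = y h"
        using \<open>h \<noteq> 0\<close> True \<open>h < i\<close> i_le k_le by (intro admissible_const[OF adm adj_h]) auto
      then show ?thesis
        using optimum_no_gap[OF gt \<open>h \<noteq> 0\<close> y] True by simp
    next
      case False
      then show ?thesis
        using adm j by (auto simp: admissible_def)
    qed
  qed
  moreover have "{k + 1..n + 1} \<subseteq> starts s'"
    using inv i_le unfolding starts by (auto simp: run_inv_def)
  ultimately show ?thesis
    using adj' \<open>h \<noteq> 0\<close> k_le unfolding s'_def[symmetric] by (simp add: run_inv_def starts)
qed

end

section \<open>The invariant along the whole run, and its consequence for blocks\<close>

lemma run_inv_step:
  assumes "clump_step I a b" "run_inv a"
  shows "run_inv b"
  using assms
proof (induction rule: clump_step.induct)
  case (call k s)
  then have "k \<in> starts s" "k + 1 \<in> starts s" "{k + 1..n + 1} \<subseteq> {k..n + 1}"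
    by (auto simp: run_inv_def)
  then have "adjacent (starts s) k (k + 1)"
    by (auto simp: adjacent_def)
  with call show ?case
    by (auto simp: run_inv_def)
next
  case (place s ps h i qs k)
  then show ?case using run_inv_place by blast
next
  case (collapse s ps h i qs k)
  then show ?case using run_inv_collapse by blast
qed (auto simp: run_inv_def all_optima_admissible_def starts_def)

lemma run_inv_init: "run_inv (clump_init I)"
proof -
  define s where "s = fst (clump_init I)"
  have init: "clump_init I = (s, Loop 1)"
    by (simp add: s_def clump_init_def)
  have starts: "starts s = {..n + 1}"
    by (auto simp: starts_def s_def clump_init_def)
  have adj: "adjacent {..n + 1} h m \<longleftrightarrow> m = Suc h \<and> h \<le> n" for h m
  proof
    assume h: "adjacent {..n + 1} h m"
    then have "\<not> Suc h < m"
      by (auto simp: adjacent_def set_eq_iff)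
    then show "m = Suc h \<and> h \<le> n"
      using h by (auto simp: adjacent_def)
  qed (auto simp: adjacent_def)
  have "curw s h = off (Suc h) - off h" for h
    by (cases "h = 0") (auto simp: s_def clump_init_def off_Suc)
  moreover have "curf s h = (\<lambda>x. G h (Suc h) (x - off h))" for h
    by (simp add: s_def clump_init_def G_def)
  moreover have "sorted_wrt (<) (clist s)" "set (clist s) = {..n}" "pos s 0 = lo"
    by (auto simp: s_def clump_init_def simp del: upt_Suc)
  ultimately have "well_formed s"
    unfolding well_formed_def starts adj by auto
  moreover have "placed_below s 1"
    by (auto simp: placed_below_def)
  \<comment> \<open>Initially every index is a start, so admissibility amounts to
    isotonicity.\<close>
  moreover have "all_optima_admissible s"
    by (auto simp: all_optima_admissible_def admissible_def starts optimal_iff)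
  ultimately show ?thesis
    by (auto simp: init run_inv_def starts)
qed

lemma run_inv_reachable:
  assumes "(clump_step I)\<^sup>*\<^sup>* (clump_init I) a"
  shows "run_inv a"
  using assms
proof (induction rule: rtranclp_induct)
  case base
  show ?case by (rule run_inv_init)
next
  case (step b c)
  from step(2,3) show ?case by (rule run_inv_step)
qed

lemma optimum_contiguous_on_blocks:
  assumes x: "srp_optimal I' x" and B: "B \<in> blocks_during_run I" and j: "j \<in> B" "j + 1 \<in> B"
  shows "x j + cwidth I j = x (j + 1)"
proof -
  obtain s i c where run: "(clump_step I)\<^sup>*\<^sup>* (clump_init I) (s, c)"
    and B_eq: "B = block I s i" and "i \<ge> 1"
    using B unfolding blocks_during_run_def mem_Collect_eq by (elim exE conjE) (rule that)
  have "optimal (\<lambda>j. x j - off j)"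
    using x by (simp add: optimal_def)
  then have "admissible (starts s) (\<lambda>j. x j - off j)"
    using run_inv_reachable[OF run] by (simp add: run_inv_def all_optima_admissible_def)
  \<comment> \<open>Since \<open>j + 1\<close> lies in the block but is not its first index, it is
    at most \<open>n\<close> and not in the list; hence it is no start. In shifted coordinates
    contiguity is then equality of consecutive values.\<close>
  moreover have "j \<in> {1..<n}" "Suc j \<notin> starts s"
    using j \<open>i \<ge> 1\<close> by (auto simp: B_eq block_def starts_def)
  ultimately show ?thesis
    using off_Suc[of j] by (auto simp: admissible_def)
qed

end

theorem theorem2p3:
  fixes I I' :: srp and x_min x_max :: real
  assumes "srp_instance I'"
    and "x_min \<le> xmin I'" and "xmin I' < xmax I'" and "xmax I' \<le> x_max"
    and "I = I'\<lparr>xmin := x_min, xmax := x_max\<rparr>"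
  shows "\<exists>xs. srp_optimal I' xs \<and>
           (\<forall>B\<in>blocks_during_run I. \<forall>j. j \<in> B \<and> j + 1 \<in> B \<longrightarrow>
              xs j + cwidth I' j = xs (j + 1))"
proof -
  interpret nested_instances I I'
    using assms(1,2,4) by unfold_locales (simp_all add: assms(5))
  obtain x where "srp_optimal I' x"
    using srp_optimal_exists[OF assms(1)] by blast
  then show ?thesis
    using optimum_contiguous_on_blocks by (auto simp: same)
qed

end
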